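(* Let $n\ge 2$, let $R>0$, let $B_R\subset\mathbb{R}^n$ be the open ball centered at the origin with radius $R$, let $\beta>0$ be a constant and let $x_0\in B_R$ with $x_0\neq 0$. Set $$\alpha^2=R^2-|x_0|^2,\qquad c_1=2\beta R,\qquad c_2=-2(\beta R+1)+n,\qquad c_3=2(\beta R+1)\alpha^2,$$ so that $c_1,c_3>0$ and $c_2\in\mathbb{R}$, and, for $t>0$, $$f(t)=c_1 t\left[c_2 t^{\frac{1}{\beta R}}+c_3 t^{\frac{2}{\beta R}}\right].$$ Then there exists a positive function $\varphi\in C^\infty(\overline{B_R})$ that is not radial in $B_R$ (i.e. $\varphi(x)$ is not a function of $|x|$ alone) and that is a solution to $$\begin{cases} -\Delta\varphi=f(\varphi) & \text{in } B_R,\\ \dfrac{\partial\varphi}{\partial\nu}+\beta\varphi=0 & \text{on }\partial B_R.\end{cases}$$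
   Context: $|\cdot|$ is the Euclidean norm in $\mathbb{R}^n$, and $\nu$ is the unit outer normal to $\partial B_R$. *)

theory Defs
  imports "HOL-Analysis.Analysis"
begin

definition has_partial_at :: "'n::finite \<Rightarrow> (real^'n \<Rightarrow> real) \<Rightarrow> real^'n \<Rightarrow> bool" where
  "has_partial_at i u x \<longleftrightarrow> (\<lambda>t. u (x + t *\<^sub>R axis i 1)) field_differentiable (at 0)"

text \<open>Meaningful at \<open>x\<close> only if \<open>has_partial_at i u x\<close>; otherwise the value is unspecified.\<close>

definition partial_deriv :: "'n::finite \<Rightarrow> (real^'n \<Rightarrow> real) \<Rightarrow> real^'n \<Rightarrow> real" where
  "partial_deriv i u x = deriv (\<lambda>t. u (x + t *\<^sub>R axis i 1)) 0"

primrec iter_partial :: "'n::finite list \<Rightarrow> (real^'n \<Rightarrow> real) \<Rightarrow> real^'n \<Rightarrow> real" where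
  "iter_partial [] u = u"
| "iter_partial (i # ks) u = partial_deriv i (iter_partial ks u)"

definition laplacian :: "(real^'n::finite \<Rightarrow> real) \<Rightarrow> real^'n \<Rightarrow> real" where
  "laplacian u x = (\<Sum>i\<in>UNIV. partial_deriv i (partial_deriv i u) x)"

text \<open>
  The class of smooth functions up to the boundary of an open set \<open>S\<close>: partial derivatives of
  all orders exist in \<open>S\<close>, and each of them extends continuously to the closure of \<open>S\<close>. The
  function itself is required to be its own continuous extension. The values of \<open>u\<close> outside
  the closure of \<open>S\<close> play no role.
\<close>

definition smooth_on_closure :: "(real^'n::finite) set \<Rightarrow> (real^'n \<Rightarrow> real) \<Rightarrow> bool" where
  "smooth_on_closure S u \<longleftrightarrow>
     continuous_on (closure S) u \<and>
     (\<forall>ks. (\<forall>x\<in>S. \<forall>i. has_partial_at i (iter_partial ks u) x) \<and>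
           (\<exists>g. continuous_on (closure S) g \<and> (\<forall>x\<in>S. g x = iter_partial ks u x)))"

text \<open>
  Derivative of \<open>u\<close> at a boundary point \<open>x\<close> in the outward direction \<open>\<nu>\<close>. It is taken from
  one side because \<open>u\<close> is only meaningful at \<open>x + t *\<^sub>R \<nu>\<close> for \<open>t \<le> 0\<close>.
\<close>

definition has_outer_derivative ::
    "(real^'n::finite \<Rightarrow> real) \<Rightarrow> real \<Rightarrow> real^'n \<Rightarrow> real^'n \<Rightarrow> bool" where
  "has_outer_derivative u d \<nu> x \<longleftrightarrow>
     ((\<lambda>t. u (x + t *\<^sub>R \<nu>)) has_real_derivative d) (at_left 0)"

definition radial_on :: "(real^'n::finite) set \<Rightarrow> (real^'n \<Rightarrow> real) \<Rightarrow> bool" where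
  "radial_on S u \<longleftrightarrow> (\<exists>g. \<forall>x\<in>S. u x = g (norm x))"

end

theory Submission
  imports Defs
begin

text \<open>
  The solution is \<open>\<phi>(x) = q(x)\<^sup>-\<^sup>m\<close> with \<open>q(x) = |x - x\<^sub>0|\<^sup>2 + \<alpha>\<^sup>2\<close> and \<open>m = \<beta>R\<close>. Since
  \<open>\<Delta>q = 2n\<close> and \<open>|\<nabla>q|\<^sup>2 = 4(q - \<alpha>\<^sup>2)\<close>, its Laplacian is a combination of \<open>q\<^sup>-\<^sup>m\<^sup>-\<^sup>1\<close> and \<open>q\<^sup>-\<^sup>m\<^sup>-\<^sup>2\<close>,
  that is, of \<open>\<phi> \<phi>\<^sup>1\<^sup>/\<^sup>m\<close> and \<open>\<phi> \<phi>\<^sup>2\<^sup>/\<^sup>m\<close>. The choice of \<open>\<alpha>\<close> makes \<open>q = 2(R\<^sup>2 - x \<bullet> x\<^sub>0)\<close> on the sphere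
  of radius \<open>R\<close>, where therefore \<open>\<partial>q/\<partial>\<nu> = q/R\<close>; this is the Robin condition.
  All derivatives of \<open>\<phi>\<close> are continuous because the coordinates and the real powers of \<open>q > 0\<close> generate
  an algebra of continuous functions that is closed under partial derivatives.
\<close>

definition shifted_sq :: "'a::real_inner \<Rightarrow> real \<Rightarrow> 'a \<Rightarrow> real" where
  "shifted_sq c a x = (x - c) \<bullet> (x - c) + a"

lemma shifted_sq_pos: "a > 0 \<Longrightarrow> shifted_sq c a x > 0"
  unfolding shifted_sq_def by (simp add: add_nonneg_pos)

text \<open>Along a line the function is a quadratic polynomial in \<open>t\<close>. The set
  \<open>A\<close> is left arbitrary so that the same formula serves the two-sided partial
  derivatives and the one-sided normal derivative on the sphere.\<close>

lemma shifted_sq_line_has_derivative: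
  "((\<lambda>t. shifted_sq c a (x + t *\<^sub>R v)) has_real_derivative 2 * ((x - c) \<bullet> v)) (at 0 within A)"
proof -
  have "(\<lambda>t. shifted_sq c a (x + t *\<^sub>R v))
      = (\<lambda>t. (x - c) \<bullet> (x - c) + 2 * t * ((x - c) \<bullet> v) + t * t * (v \<bullet> v) + a)"
    by (simp add: shifted_sq_def algebra_simps inner_commute)
  then show ?thesis
    by (auto intro!: derivative_eq_intros)
qed

lemma shifted_sq_powr_line_has_derivative:
  assumes "a > 0"
  shows "((\<lambda>t. shifted_sq c a (x + t *\<^sub>R v) powr s) has_real_derivative
           2 * s * ((x - c) \<bullet> v) * shifted_sq c a x powr (s - 1)) (at 0 within A)"
proof -
  have "((\<lambda>q. q powr s) has_real_derivative s * shifted_sq c a x powr (s - 1))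
          (at (shifted_sq c a (x + 0 *\<^sub>R v)))"
    using has_real_derivative_powr[OF shifted_sq_pos[OF assms]] by simp
  from DERIV_chain2[OF this shifted_sq_line_has_derivative] show ?thesis
    by (simp add: mult_ac)
qed

lemma coordinate_line_has_derivative:
  fixes x :: "real^'n::finite"
  shows "((\<lambda>t. (x + t *\<^sub>R axis i 1) $ j) has_real_derivative (if j = i then 1 else 0)) (at 0)"
  by (auto simp: axis_def intro!: derivative_eq_intros)

lemma partial_derivI:
  "((\<lambda>t. u (x + t *\<^sub>R axis i 1)) has_real_derivative d) (at 0) \<Longrightarrow> partial_deriv i u x = d"
  unfolding partial_deriv_def by (rule DERIV_imp_deriv)

text \<open>The exponent \<open>s\<close> ranges over all reals because each differentiation lowers
  it by one. Coordinates are among the generators because the inner derivative contributes the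
  factor \<open>2 * (x $ i - c $ i)\<close>.\<close>

inductive_set sq_powr_algebra :: "real^'n::finite \<Rightarrow> real \<Rightarrow> (real^'n \<Rightarrow> real) set"
  for c :: "real^'n" and a :: real where
  const: "(\<lambda>x. k) \<in> sq_powr_algebra c a"
| coord: "(\<lambda>x. x $ j) \<in> sq_powr_algebra c a"
| powr: "(\<lambda>x. shifted_sq c a x powr s) \<in> sq_powr_algebra c a"
| add: "u \<in> sq_powr_algebra c a \<Longrightarrow> v \<in> sq_powr_algebra c a
    \<Longrightarrow> (\<lambda>x. u x + v x) \<in> sq_powr_algebra c a"
| mult: "u \<in> sq_powr_algebra c a \<Longrightarrow> v \<in> sq_powr_algebra c a
    \<Longrightarrow> (\<lambda>x. u x * v x) \<in> sq_powr_algebra c a"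

lemma sq_powr_algebra_continuous:
  assumes "a > 0" "u \<in> sq_powr_algebra c a"
  shows "continuous_on S u"
  using assms(2)
proof induction
  case (powr s)
  have "shifted_sq c a x \<noteq> 0" for x
    using shifted_sq_pos[OF assms(1), of c x] by simp
  then show ?case
    by (intro continuous_on_powr) (auto simp: shifted_sq_def intro!: continuous_intros)
qed (auto intro!: continuous_intros)

text \<open>One \<open>u'\<close> serves all points \<open>x\<close>, so it is the partial
  derivative as a function and can be differentiated again. The induction follows the sum, product
  and chain rules.\<close>

lemma sq_powr_algebra_derivative:
  assumes "a > 0" "u \<in> sq_powr_algebra c a"
  shows "\<exists>u' \<in> sq_powr_algebra c a. \<forall>x.
    ((\<lambda>t. u (x + t *\<^sub>R axis i 1)) has_real_derivative u' x) (at 0)"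
  using assms(2)
proof induction
  case (const k)
  show ?case
    by (rule bexI[OF _ sq_powr_algebra.const[of 0]]) simp
next
  case (coord j)
  show ?case
    by (rule bexI[OF _ sq_powr_algebra.const[of "if j = i then 1 else 0"]])
       (use coordinate_line_has_derivative in blast)
next
  case (powr s)
  \<comment> \<open>The difference is written as a sum with a constant, since the algebra is built
    from sums and products.\<close>
  have "(\<lambda>x. 2 * s * (x $ i + - (c $ i)) * shifted_sq c a x powr (s - 1)) \<in> sq_powr_algebra c a"
    by (intro sq_powr_algebra.intros)
  moreover have "((\<lambda>t. shifted_sq c a (x + t *\<^sub>R axis i 1) powr s) has_real_derivative
      2 * s * (x $ i + - (c $ i)) * shifted_sq c a x powr (s - 1)) (at 0)" for x
    using shifted_sq_powr_line_has_derivative[OF assms(1), of c x "axis i 1"]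
    by (simp add: inner_axis)
  ultimately show ?case
    by (intro bexI[rotated] allI)
next
  case (add u v)
  then obtain u' v' where "u' \<in> sq_powr_algebra c a" "v' \<in> sq_powr_algebra c a"
    and "\<And>x. ((\<lambda>t. u (x + t *\<^sub>R axis i 1)) has_real_derivative u' x) (at 0)"
    and "\<And>x. ((\<lambda>t. v (x + t *\<^sub>R axis i 1)) has_real_derivative v' x) (at 0)"
    by blast
  then show ?case
    by (intro bexI[of _ "\<lambda>x. u' x + v' x"] allI DERIV_add sq_powr_algebra.add)
next
  case (mult u v)
  then obtain u' v' where mem: "u' \<in> sq_powr_algebra c a" "v' \<in> sq_powr_algebra c a"
    and "\<And>x. ((\<lambda>t. u (x + t *\<^sub>R axis i 1)) has_real_derivative u' x) (at 0)"
    and "\<And>x. ((\<lambda>t. v (x + t *\<^sub>R axis i 1)) has_real_derivative v' x) (at 0)"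
    by blast
  then have "((\<lambda>t. u (x + t *\<^sub>R axis i 1) * v (x + t *\<^sub>R axis i 1))
      has_real_derivative u' x * v x + v' x * u x) (at 0)" for x
    using DERIV_mult[of "\<lambda>t. u (x + t *\<^sub>R axis i 1)" "u' x" 0 UNIV
        "\<lambda>t. v (x + t *\<^sub>R axis i 1)" "v' x"] by simp
  moreover have "(\<lambda>x. u' x * v x + v' x * u x) \<in> sq_powr_algebra c a"
    using mult.hyps mem by (intro sq_powr_algebra.add sq_powr_algebra.mult)
  ultimately show ?case
    by (intro bexI[rotated] allI)
qed

lemma sq_powr_algebra_iter_partial:
  assumes "a > 0" "u \<in> sq_powr_algebra c a"
  shows "iter_partial ks u \<in> sq_powr_algebra c a"
proof (induction ks)
  case (Cons i ks)
  then obtain u' where "u' \<in> sq_powr_algebra c a" and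
    "\<forall>x. ((\<lambda>t. iter_partial ks u (x + t *\<^sub>R axis i 1)) has_real_derivative u' x) (at 0)"
    using sq_powr_algebra_derivative[OF assms(1)] by blast
  moreover from this have "partial_deriv i (iter_partial ks u) = u'"
    by (auto intro: partial_derivI)
  ultimately show ?case by simp
qed (simp add: assms)

lemma sq_powr_algebra_smooth_on_closure:
  assumes "a > 0" "u \<in> sq_powr_algebra c a"
  shows "smooth_on_closure S u"
  unfolding smooth_on_closure_def
proof (intro conjI allI ballI)
  show "continuous_on (closure S) u"
    using sq_powr_algebra_continuous[OF assms] .
next
  fix ks x i
  show "has_partial_at i (iter_partial ks u) x"
    using sq_powr_algebra_derivative[OF assms(1) sq_powr_algebra_iter_partial[OF assms]]
    unfolding has_partial_at_def field_differentiable_def by blast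
next
  fix ks
  \<comment> \<open>Each iterated partial derivative is continuous on the whole space and serves as
    its own extension.\<close>
  show "\<exists>g. continuous_on (closure S) g \<and> (\<forall>x\<in>S. g x = iter_partial ks u x)"
    using sq_powr_algebra_continuous[OF assms(1) sq_powr_algebra_iter_partial[OF assms]] by blast
qed

text \<open>Summing the second partial derivatives turns the squares
  \<open>(x $ i - c $ i)\<^sup>2\<close> into \<open>q - a\<close>, where \<open>q\<close> is the
  value of \<open>shifted_sq c a\<close> at \<open>x\<close>. The part with \<open>q\<close> raises
  the exponent \<open>s - 2\<close> to \<open>s - 1\<close> and joins the first term; the part with
  \<open>a\<close> remains.\<close>

lemma laplacian_shifted_sq_powr:
  fixes c :: "real^'n::finite"
  assumes "a > 0"
  shows "laplacian (\<lambda>x. shifted_sq c a x powr s) x =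
    2 * s * (real CARD('n) + 2 * (s - 1)) * shifted_sq c a x powr (s - 1)
      - 4 * s * (s - 1) * a * shifted_sq c a x powr (s - 2)"
proof -
  let ?q = "shifted_sq c a"
  have first: "partial_deriv i (\<lambda>x. ?q x powr s) = (\<lambda>x. 2 * s * (x $ i - c $ i) * ?q x powr (s - 1))"
    for i
    using shifted_sq_powr_line_has_derivative[OF assms, of c _ "axis i 1" s UNIV]
    by (auto intro!: partial_derivI simp: inner_axis)
  have second: "partial_deriv i (\<lambda>x. 2 * s * (x $ i - c $ i) * ?q x powr (s - 1)) x =
      2 * s * ?q x powr (s - 1) + 4 * s * (s - 1) * (x $ i - c $ i)\<^sup>2 * ?q x powr (s - 2)" for i
  proof (rule partial_derivI)
    have "((\<lambda>t. 2 * s * ((x + t *\<^sub>R axis i 1) $ i - c $ i)) has_real_derivative 2 * s) (at 0)"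
      using coordinate_line_has_derivative[of x i i] by (auto intro!: derivative_eq_intros)
    moreover have "((\<lambda>t. ?q (x + t *\<^sub>R axis i 1) powr (s - 1)) has_real_derivative
        2 * (s - 1) * (x $ i - c $ i) * ?q x powr (s - 2)) (at 0)"
      using shifted_sq_powr_line_has_derivative[OF assms, of c x "axis i 1" "s - 1" UNIV]
      by (simp add: inner_axis)
    ultimately show "((\<lambda>t. 2 * s * ((x + t *\<^sub>R axis i 1) $ i - c $ i) * ?q (x + t *\<^sub>R axis i 1) powr (s - 1))
        has_real_derivative 2 * s * ?q x powr (s - 1)
          + 4 * s * (s - 1) * (x $ i - c $ i)\<^sup>2 * ?q x powr (s - 2)) (at 0)"
      by (rule DERIV_cong[OF DERIV_mult]) (simp add: power2_eq_square algebra_simps)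
  qed
  have sum_sq: "(\<Sum>i\<in>UNIV. (x $ i - c $ i)\<^sup>2) = ?q x - a"
    by (simp add: shifted_sq_def inner_vec_def power2_eq_square)
  have "?q x powr (s - 2) * ?q x = ?q x powr (s - 1)"
    using powr_add[of "?q x" "s - 2" 1] shifted_sq_pos[OF assms, of c x] by simp
  moreover have "laplacian (\<lambda>x. ?q x powr s) x =
      real CARD('n) * (2 * s * ?q x powr (s - 1)) + 4 * s * (s - 1) * (?q x - a) * ?q x powr (s - 2)"
    unfolding laplacian_def first second sum.distrib
    by (simp add: sum_sq flip: sum_distrib_left sum_distrib_right)
  ultimately show ?thesis
    by (simp add: algebra_simps)
qed

theorem theorem3p1:
  fixes x0 :: "real^'n" and R \<beta> \<alpha> c1 c2 c3 :: real and f :: "real \<Rightarrow> real"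
  assumes "CARD('n) \<ge> 2"
    and "R > 0" and "\<beta> > 0"
    and "x0 \<in> ball 0 R" and "x0 \<noteq> 0"
    and "\<alpha>\<^sup>2 = R\<^sup>2 - (norm x0)\<^sup>2"
    and "c1 = 2 * \<beta> * R"
    and "c2 = - 2 * (\<beta> * R + 1) + real CARD('n)"
    and "c3 = 2 * (\<beta> * R + 1) * \<alpha>\<^sup>2"
    and "\<And>t. t > 0 \<Longrightarrow>
           f t = c1 * t * (c2 * t powr (1 / (\<beta> * R)) + c3 * t powr (2 / (\<beta> * R)))"
  shows "c1 > 0 \<and> c3 > 0 \<and>
    (\<exists>\<phi> :: real^'n \<Rightarrow> real.
       smooth_on_closure (ball 0 R) \<phi> \<and>
       (\<forall>x\<in>cball 0 R. \<phi> x > 0) \<and>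
       \<not> radial_on (ball 0 R) \<phi> \<and>
       (\<forall>x\<in>ball 0 R. - laplacian \<phi> x = f (\<phi> x)) \<and>
       (\<forall>x\<in>sphere 0 R. \<exists>d. has_outer_derivative \<phi> d ((1 / R) *\<^sub>R x) x \<and> d + \<beta> * \<phi> x = 0))"
proof (intro conjI)
  define m where "m = \<beta> * R"
  define q where "q = shifted_sq x0 (\<alpha>\<^sup>2)"
  let ?\<phi> = "\<lambda>x. q x powr (- m)"
  have m: "m > 0"
    using assms(2,3) by (simp add: m_def)
  have "(norm x0)\<^sup>2 < R\<^sup>2"
    using assms(4) by (intro power_strict_mono) auto
  then have a: "\<alpha>\<^sup>2 > 0"
    using assms(6) by simp
  have q: "q x > 0" for x
    unfolding q_def using a by (rule shifted_sq_pos)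
  show "c1 > 0"
    using assms(2,3,7) by simp
  show "c3 > 0"
    unfolding assms(9) using m a by (intro mult_pos_pos) (auto simp: m_def)
  show "\<exists>\<phi> :: real^'n \<Rightarrow> real.
       smooth_on_closure (ball 0 R) \<phi> \<and>
       (\<forall>x\<in>cball 0 R. \<phi> x > 0) \<and>
       \<not> radial_on (ball 0 R) \<phi> \<and>
       (\<forall>x\<in>ball 0 R. - laplacian \<phi> x = f (\<phi> x)) \<and>
       (\<forall>x\<in>sphere 0 R. \<exists>d. has_outer_derivative \<phi> d ((1 / R) *\<^sub>R x) x \<and> d + \<beta> * \<phi> x = 0)"
  proof (intro exI[of _ ?\<phi>] conjI ballI)
    show "smooth_on_closure (ball 0 R) ?\<phi>"
      unfolding q_def using a sq_powr_algebra.powr by (rule sq_powr_algebra_smooth_on_closure)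
    show "?\<phi> x > 0" for x
      using q[of x] by simp
    show "\<not> radial_on (ball 0 R) ?\<phi>"
    proof
      assume "radial_on (ball 0 R) ?\<phi>"
      then obtain g where "\<forall>x\<in>ball 0 R. ?\<phi> x = g (norm x)"
        unfolding radial_on_def by blast
      \<comment> \<open>The points \<open>x0\<close> and \<open>- x0\<close> have the same norm, but
        \<open>q\<close> takes the value \<open>\<alpha>\<^sup>2\<close> at the first and
        \<open>4 * (x0 \<bullet> x0) + \<alpha>\<^sup>2\<close> at the second. These differ as
        \<open>x0 \<noteq> 0\<close>, and a negative power is strictly decreasing.\<close>
      then have "?\<phi> x0 = ?\<phi> (- x0)"
        using assms(4) by simp
      moreover have "(- x0 - x0) \<bullet> (- x0 - x0) = 4 * (x0 \<bullet> x0)"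
        by (simp only: inner_diff_left inner_diff_right inner_minus_left inner_minus_right)
      then have "q x0 < q (- x0)"
        using assms(5) by (simp only: q_def shifted_sq_def) simp
      ultimately show False
        using powr_less_mono2_neg[of "- m" "q x0" "q (- x0)"] m q by simp
    qed
  next
    fix x :: "real^'n"
    have e: "?\<phi> x powr (1 / m) = q x powr (- 1)" "?\<phi> x powr (2 / m) = q x powr (- 2)"
      using m by (simp_all add: powr_powr)
    have "q x powr (- m - 1) = ?\<phi> x * q x powr (- 1)" "q x powr (- m - 2) = ?\<phi> x * q x powr (- 2)"
      using powr_add[of "q x" "- m" "- 1"] powr_add[of "q x" "- m" "- 2"] by simp_all
    \<comment> \<open>With \<open>s = - m\<close> in the formula for the Laplacian, the factor
      \<open>2 * m\<close> is \<open>c1\<close>, and the coefficients in the bracket are exactly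
      \<open>c2\<close> and \<open>c3\<close>.\<close>
    then have "- laplacian ?\<phi> x = 2 * m * ?\<phi> x *
        ((- 2 * (m + 1) + real CARD('n)) * q x powr (- 1) + 2 * (m + 1) * \<alpha>\<^sup>2 * q x powr (- 2))"
      using laplacian_shifted_sq_powr[OF a, of x0 "- m" x, folded q_def]
      by (simp only:) (simp add: algebra_simps)
    also have "\<dots> = f (?\<phi> x)"
      using assms(10)[of "?\<phi> x"] q[of x] e by (simp add: assms(7-9) m_def mult.assoc)
    finally show "- laplacian ?\<phi> x = f (?\<phi> x)" .
  next
    fix x :: "real^'n"
    assume "x \<in> sphere 0 R"
    then have x: "x \<bullet> x = R\<^sup>2"
      by (simp add: dot_square_norm)
    have "q x = 2 * (R\<^sup>2 - x \<bullet> x0)"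
      unfolding q_def shifted_sq_def assms(6) power2_norm_eq_inner
      by (simp add: x inner_diff_left inner_diff_right inner_commute)
    then have normal: "2 * ((x - x0) \<bullet> ((1 / R) *\<^sub>R x)) = q x / R"
      using x by (simp add: inner_diff_left inner_diff_right inner_commute)
    have step: "q x * q x powr (- m - 1) = ?\<phi> x"
      using powr_add[of "q x" 1 "- m - 1"] q[of x] by simp
    have "has_outer_derivative ?\<phi>
        (2 * - m * ((x - x0) \<bullet> ((1 / R) *\<^sub>R x)) * q x powr (- m - 1)) ((1 / R) *\<^sub>R x) x"
      unfolding has_outer_derivative_def q_def by (rule shifted_sq_powr_line_has_derivative[OF a])
    \<comment> \<open>This fixes the exponent: the normal derivative \<open>q x / R\<close> of
      \<open>q\<close> restores the power \<open>- m\<close> and leaves the factor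
      \<open>- m / R\<close>, which is \<open>- \<beta>\<close> exactly for
      \<open>m = \<beta> * R\<close>.\<close>
    moreover have "2 * - m * ((x - x0) \<bullet> ((1 / R) *\<^sub>R x)) * q x powr (- m - 1) = - \<beta> * ?\<phi> x"
    proof -
      have "2 * - m * ((x - x0) \<bullet> ((1 / R) *\<^sub>R x)) * q x powr (- m - 1)
          = - m * (2 * ((x - x0) \<bullet> ((1 / R) *\<^sub>R x))) * q x powr (- m - 1)"
        by simp
      also have "\<dots> = - (m / R) * (q x * q x powr (- m - 1))"
        unfolding normal by simp
      finally show ?thesis
        unfolding step using assms(2) by (simp add: m_def)
    qed
    ultimately show "\<exists>d. has_outer_derivative ?\<phi> d ((1 / R) *\<^sub>R x) x \<and> d + \<beta> * ?\<phi> x = 0"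
      by (intro exI[of _ "- \<beta> * ?\<phi> x"]) simp
  qed
qed

end
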